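(* Let $n, m, k$ be positive integers with $(n,m) \notin \{(1,1),(2,2)\}$. Then $\mathrm{sg}(K_{n,m}) = k$ if and only if at least one of the following three conditions holds: (i) $n < k$ and $m = f(k, n)$; (ii) $m < k$ and $n = f(k, m)$; (iii) there is an integer $i$ with $0 \leq i \leq k$ such that $f(k, i-1) \leq m \leq f(k, i)$ and $f(k, k-i-1) \leq n \leq f(k, k-i)$. In the two exceptional cases, $\mathrm{sg}(K_{1,1}) = 2$ and $\mathrm{sg}(K_{2,2}) = 3$.
   Context: For integers $\alpha, \beta$ define $f(\alpha, \beta) = \alpha - 1 + \binom{\max\{\beta-1, 2\}}{2}$. $K_{n,m}$ denotes the complete bipartite graph with parts of sizes $n$ and $m$. Let $G=(V,E)$ be a finite simple graph. For a set $S\subseteq V$ and for each pair of distinct vertices $\{x,y\}\subseteq S$, select one fixed shortest path $\widetilde{g}(x,y)$ between $x$ and $y$ in $G$. If the selection can be made so that the selected shortest paths (one per pair) together cover all vertices of $G$, i.e. the union of their vertex sets is $V$, then $S$ is called a strong geodetic set of $G$. If $G$ has just one vertex, that vertex is considered the unique strong geodetic set. The strong geodetic number $\mathrm{sg}(G)$ is the minimum size of a strong geodetic set of $G$. *)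

theory Defs
  imports "Graph_Theory.Graph_Theory"
begin

text \<open>
  Finite simple graphs are the symmetric digraphs of the locale \<^locale>\<open>graph\<close> (finite, without
  loops or parallel arcs), and the complete bipartite graph is the predicate
  \<^const>\<open>complete_bipartite_digraph\<close>.  Since there are no parallel arcs, paths are represented by
  their vertex lists.
\<close>

definition shortest_vpath :: "('a, 'b) pre_digraph \<Rightarrow> 'a \<Rightarrow> 'a vwalk \<Rightarrow> 'a \<Rightarrow> bool" where
  "shortest_vpath G x p y \<longleftrightarrow>
     vpath p G \<and> hd p = x \<and> last p = y \<and>
     (\<forall>q. vpath q G \<and> hd q = x \<and> last q = y \<longrightarrow> vwalk_length p \<le> vwalk_length q)"

text \<open>
  The selection \<open>g\<close> is indexed by two-element subsets, so each unordered pair receives a single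
  path; the list \<open>g P\<close> may run in either direction.
\<close>

definition strong_geodetic_set :: "('a, 'b) pre_digraph \<Rightarrow> 'a set \<Rightarrow> bool" where
  "strong_geodetic_set G S \<longleftrightarrow>
     (if card (verts G) = 1 then S = verts G
      else S \<subseteq> verts G \<and>
        (\<exists>g :: 'a set \<Rightarrow> 'a vwalk.
           (\<forall>P. P \<subseteq> S \<and> card P = 2 \<longrightarrow> (\<exists>x y. P = {x, y} \<and> shortest_vpath G x (g P) y)) \<and>
           (\<Union>P \<in> {P. P \<subseteq> S \<and> card P = 2}. set (g P)) = verts G))"

text \<open>
  Meaningful for graphs that possess a strong geodetic set, in particular for all nonempty
  connected finite graphs, where the full vertex set is one.
\<close>

definition strong_geodetic_number :: "('a, 'b) pre_digraph \<Rightarrow> nat" where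
  "strong_geodetic_number G = (LEAST s. \<exists>S. strong_geodetic_set G S \<and> card S = s)"

text \<open>
  Integer arguments, because the second one may be negative; the argument of \<^const>\<open>nat\<close> is
  at least 2, so nothing is truncated.
\<close>

definition sg_bound :: "int \<Rightarrow> int \<Rightarrow> int" where
  "sg_bound a b = a - 1 + int (nat (max (b - 1) 2) choose 2)"

text \<open>The predicate \<^const>\<open>complete_bipartite_digraph\<close> is satisfiable for all part sizes.\<close>

lemma complete_bipartite_digraph_exists:
  "\<exists>G :: (nat, nat \<times> nat) pre_digraph. complete_bipartite_digraph n m G"
proof -
  let ?U = "{..<n}" and ?V = "{n..<n + m}"
  have "complete_bipartite_digraph n m
          (with_proj \<lparr>pverts = ?U \<union> ?V, parcs = ?U \<times> ?V \<union> ?V \<times> ?U\<rparr>)"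
    unfolding complete_bipartite_digraph_pair_def
    by (intro conjI, simp, rule exI[of _ ?U], rule exI[of _ ?V], auto)
  then show ?thesis by blast
qed

end

theory Submission
  imports Defs
begin

text \<open>
  If \<open>S\<close> meets the parts \<open>U\<close>, \<open>V\<close> in \<open>a\<close> and \<open>b\<close> vertices, only the pairs inside one part have
  shortest paths with an inner vertex, and that vertex is an arbitrary one of the other part.
  So \<open>S\<close> can be made strong geodetic iff \<open>m \<le> b + (a choose 2)\<close> and \<open>n \<le> a + (b choose 2)\<close>.  This
  admissibility of \<open>k = a + b\<close> is preserved when \<open>k\<close> grows up to \<open>n + m\<close>, so the strong geodetic
  number is \<open>k\<close> iff \<open>k\<close> is admissible and \<open>k - 1\<close> is not.  Moreover \<open>b + (a choose 2)\<close> is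
  \<open>f(k, a)\<close>, except that it is \<open>k - 1\<close> instead of \<open>k\<close> for \<open>a = 1, 2\<close>.  If \<open>n, m \<ge> k\<close>, the
  index in condition (iii) is the greatest \<open>i \<le> k\<close> with \<open>f(k, i - 1) \<le> m\<close> and \<open>n \<le> f(k, k - i)\<close>.
\<close>

section \<open>Strong geodetic sets of complete bipartite graphs\<close>

text \<open>The parts are parameters, so that every fact about one part transfers to the other by
  interpreting the locale with \<open>U\<close> and \<open>V\<close> exchanged.\<close>

locale complete_bipartition =
  fixes G :: "('a, 'b) pre_digraph" and U V :: "'a set"
  assumes finite_parts: "finite U" "finite V"
    and nonempty_parts: "U \<noteq> {}" "V \<noteq> {}"
    and disjoint: "U \<inter> V = {}"
    and verts_eq: "verts G = U \<union> V"
    and ends_eq: "arcs_ends G = U \<times> V \<union> V \<times> U"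
begin

section \<open>Shortest paths inside and between the parts\<close>

lemma swapped: "complete_bipartition G V U"
  using finite_parts nonempty_parts disjoint verts_eq ends_eq by unfold_locales auto

lemma vpath_via:
  assumes "x \<in> U" "y \<in> U" "x \<noteq> y" "z \<in> V"
  shows "vpath [x, z, y] G"
  using assms disjoint verts_eq ends_eq by (auto simp: vpath_def vwalk_def)

lemma vpath_edge:
  assumes "x \<in> U" "y \<in> V"
  shows "vpath [x, y] G"
  using assms disjoint verts_eq ends_eq by (auto simp: vpath_def vwalk_def)

text \<open>A path with at most two vertices has equal ends or joins different parts.\<close>

lemma vpath_same_part_length:
  assumes "vpath q G" "hd q = x" "last q = y" "x \<in> U" "y \<in> U" "x \<noteq> y"
  shows "vwalk_length q \<ge> 2"
proof (rule ccontr)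
  assume "\<not> ?thesis"
  then have "length q \<le> 2" by simp
  moreover have "q \<noteq> []" using assms by (auto simp: vpath_def vwalk_def)
  ultimately consider u where "q = [u]" | u v where "q = [u, v]"
    by (cases q; cases "tl q") auto
  then show False
    using assms disjoint ends_eq by cases (auto simp: vpath_def vwalk_def)
qed

lemma shortest_vpath_via:
  assumes "x \<in> U" "y \<in> U" "x \<noteq> y" "z \<in> V"
  shows "shortest_vpath G x [x, z, y] y"
  using vpath_via[OF assms] vpath_same_part_length[OF _ _ _ assms(1-3)]
  by (simp add: shortest_vpath_def numeral_2_eq_2)

text \<open>Comparison with a path through any vertex of \<open>V\<close> leaves exactly three
  vertices, and a neighbour of \<open>x\<close> in \<open>U\<close> lies in
  \<open>V\<close>.\<close>

lemma shortest_vpath_same_part: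
  assumes "shortest_vpath G x p y" "x \<in> U" "y \<in> U" "x \<noteq> y"
  shows "\<exists>z\<in>V. set p = {x, y, z}"
proof -
  obtain z where "z \<in> V" using nonempty_parts by blast
  then have "vwalk_length p \<le> vwalk_length [x, z, y]"
    using assms vpath_via[of x y z] unfolding shortest_vpath_def
    by (metis last.simps list.distinct(1) list.sel(1))
  moreover have "vwalk_length p \<ge> 2"
    using assms vpath_same_part_length unfolding shortest_vpath_def by blast
  ultimately have "length p = 3" by simp
  then obtain u v w where "p = [u, v, w]"
    by (auto simp: numeral_3_eq_3 length_Suc_conv)
  then show ?thesis
    using assms disjoint ends_eq by (auto simp: shortest_vpath_def vpath_def vwalk_def)
qed

lemma shortest_vpath_edge:
  assumes "x \<in> U" "y \<in> V"
  shows "shortest_vpath G x [x, y] y"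
proof -
  have "vwalk_length q \<ge> 1" if "vpath q G" "hd q = x" "last q = y" for q
  proof (rule ccontr)
    assume "\<not> ?thesis"
    then have "length q \<le> 1" by simp
    moreover have "q \<noteq> []" using that by (auto simp: vpath_def vwalk_def)
    ultimately obtain u where "q = [u]" by (cases q) auto
    then show False using that assms disjoint by auto
  qed
  then show ?thesis using vpath_edge[OF assms] by (fastforce simp: shortest_vpath_def)
qed

text \<open>Such a path is a single edge, so it covers nothing beyond its ends. Both orders of the
  parts are allowed because a selected path may run in either direction.\<close>

lemma shortest_vpath_cross:
  assumes "shortest_vpath G x p y" "x \<in> U \<and> y \<in> V \<or> x \<in> V \<and> y \<in> U"
  shows "set p = {x, y}"
proof -
  interpret sw: complete_bipartition G V U by (rule swapped)
  have "vwalk_length p \<le> vwalk_length [x, y]"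
    using assms vpath_edge[of x y] sw.vpath_edge[of x y] unfolding shortest_vpath_def
    by (metis last.simps list.distinct(1) list.sel(1))
  then have "length p \<le> 2" by simp
  moreover have "p \<noteq> []" using assms by (auto simp: shortest_vpath_def vpath_def vwalk_def)
  ultimately consider u where "p = [u]" | u v where "p = [u, v]"
    by (cases p; cases "tl p") auto
  then show ?thesis
    using assms disjoint by cases (auto simp: shortest_vpath_def)
qed

section \<open>Covering the vertices outside the chosen set\<close>

text \<open>A vertex of \<open>V - S\<close> is never an end of a selected path, and only pairs
  inside \<open>U\<close> have inner vertices in \<open>V\<close>. Hence sending a pair in
  \<open>S \<inter> U\<close> to its inner vertex reaches all of \<open>V - S\<close>.\<close>

lemma card_uncovered_le:
  assumes "S \<subseteq> verts G"
    and g: "\<And>P. P \<subseteq> S \<Longrightarrow> card P = 2 \<Longrightarrow> \<exists>x y. P = {x, y} \<and> shortest_vpath G x (g P) y"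
    and cover: "V \<subseteq> (\<Union>P \<in> {P. P \<subseteq> S \<and> card P = 2}. set (g P))"
  shows "card (V - S) \<le> (card (S \<inter> U) choose 2)"
proof -
  interpret sw: complete_bipartition G V U by (rule swapped)
  let ?Q = "{P. P \<subseteq> S \<inter> U \<and> card P = 2}"
  have "\<exists>z\<in>V. set (g P) = insert z P" if P: "P \<in> ?Q" for P
  proof -
    have "\<exists>x y. P = {x, y} \<and> shortest_vpath G x (g P) y" using P by (intro g) auto
    then obtain x y where xy: "P = {x, y}" "shortest_vpath G x (g P) y" by blast
    moreover have "x \<in> U" "y \<in> U" "x \<noteq> y" using xy P by auto
    ultimately show ?thesis using shortest_vpath_same_part by blast
  qed
  then obtain z where z: "\<And>P. P \<in> ?Q \<Longrightarrow> z P \<in> V \<and> set (g P) = insert (z P) P"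
    by metis
  have "V - S \<subseteq> z ` ?Q"
  proof
    fix v assume v: "v \<in> V - S"
    then obtain P where P: "P \<subseteq> S" "card P = 2" "v \<in> set (g P)" using cover by blast
    obtain x y where xy: "P = {x, y}" "shortest_vpath G x (g P) y" using g P by blast
    have ne: "x \<noteq> y" using xy P by auto
    have S: "x \<in> S" "y \<in> S" using xy P by auto
    have "P \<subseteq> U"
    proof (rule ccontr)
      assume "\<not> P \<subseteq> U"
      then consider "x \<in> U \<and> y \<in> V \<or> x \<in> V \<and> y \<in> U" | "x \<in> V" "y \<in> V"
        using xy S assms(1) verts_eq by blast
      then show False
      proof cases
        case 1
        then show False using shortest_vpath_cross[OF xy(2)] P v S by auto
      next
        case 2
        then show False using sw.shortest_vpath_same_part[OF xy(2) 2 ne] P v S disjoint by auto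
      qed
    qed
    then have Q: "P \<in> ?Q" using P by auto
    have "v = z P" using z[OF Q] P v by auto
    with Q show "v \<in> z ` ?Q" by blast
  qed
  moreover have "finite ?Q" using finite_parts by simp
  ultimately have "card (V - S) \<le> card ?Q" by (intro surj_card_le)
  then show ?thesis using n_subsets[of "S \<inter> U" 2] finite_parts by simp
qed

text \<open>The counting bound yields an injection of \<open>V - B\<close> into the pairs of
  \<open>A\<close>; its inverse tells each pair which vertex to cover.\<close>

lemma inner_vertex_assignment:
  assumes "A \<subseteq> U" "card (V - B) \<le> (card A choose 2)"
  obtains z where "\<And>P. z P \<in> V" "V - B \<subseteq> z ` {P. P \<subseteq> A \<and> card P = 2}"
proof -
  let ?Q = "{P. P \<subseteq> A \<and> card P = 2}"
  have "finite A" using assms finite_parts finite_subset by blast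
  then have Q: "finite ?Q" "card ?Q = (card A choose 2)" by (auto simp: n_subsets)
  obtain h where h: "inj_on h (V - B)" "h ` (V - B) \<subseteq> ?Q"
    using card_le_inj[of "V - B" ?Q] assms Q finite_parts by auto
  obtain v where v: "v \<in> V" using nonempty_parts by blast
  \<comment> \<open>Sets outside the image of \<open>h\<close> receive the default \<open>v\<close>,
    so that \<open>z P\<close> lies in \<open>V\<close> for every \<open>P\<close>.\<close>
  define z where "z P = (if P \<in> h ` (V - B) then the_inv_into (V - B) h P else v)" for P
  have "z P \<in> V" for P
    using v the_inv_into_into[OF h(1), of P "V - B"] by (auto simp: z_def)
  moreover have "w \<in> z ` ?Q" if "w \<in> V - B" for w
  proof (rule image_eqI)
    show "w = z (h w)" using that h(1) by (simp add: z_def the_inv_into_f_f)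
    show "h w \<in> ?Q" using that h(2) by blast
  qed
  ultimately show ?thesis using that by blast
qed

text \<open>Pairs inside \<open>U\<close> serve only \<open>V\<close> and conversely, so the two
  counting conditions can be met separately and the choices combined into one selection.\<close>

lemma strong_geodetic_set_iff:
  "strong_geodetic_set G S \<longleftrightarrow> S \<subseteq> verts G \<and> card S \<ge> 2 \<and>
     card (V - S) \<le> (card (S \<inter> U) choose 2) \<and> card (U - S) \<le> (card (S \<inter> V) choose 2)"
    (is "_ \<longleftrightarrow> ?R")
proof -
  interpret sw: complete_bipartition G V U by (rule swapped)
  have "card U > 0" "card V > 0"
    using finite_parts nonempty_parts by auto
  \<comment> \<open>Both parts are nonempty, so the convention for one-vertex graphs does not
    apply.\<close>
  then have "card (verts G) \<noteq> 1"
    using verts_eq card_Un_disjoint[OF finite_parts disjoint] by simp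
  then have def: "strong_geodetic_set G S \<longleftrightarrow> S \<subseteq> verts G \<and>
        (\<exists>g :: 'a set \<Rightarrow> 'a vwalk.
           (\<forall>P. P \<subseteq> S \<and> card P = 2 \<longrightarrow> (\<exists>x y. P = {x, y} \<and> shortest_vpath G x (g P) y)) \<and>
           (\<Union>P \<in> {P. P \<subseteq> S \<and> card P = 2}. set (g P)) = verts G)"
    by (simp add: strong_geodetic_set_def)
  have fin: "finite S" if "S \<subseteq> verts G"
    using that finite_parts verts_eq finite_subset by fastforce
  show ?thesis
  proof
    assume "strong_geodetic_set G S"
    then obtain g where S: "S \<subseteq> verts G"
      and g_all: "\<forall>P. P \<subseteq> S \<and> card P = 2 \<longrightarrow> (\<exists>x y. P = {x, y} \<and> shortest_vpath G x (g P) y)"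
      and cover: "(\<Union>P \<in> {P. P \<subseteq> S \<and> card P = 2}. set (g P)) = verts G"
      unfolding def by (elim conjE exE) (rule that)
    have g: "\<exists>x y. P = {x, y} \<and> shortest_vpath G x (g P) y" if "P \<subseteq> S" "card P = 2" for P
      using g_all that by simp
    obtain P where P: "P \<subseteq> S" "card P = 2"
      using cover verts_eq nonempty_parts by blast
    then have "card S \<ge> 2" using card_mono[OF fin[OF S] P(1)] by simp
    moreover have "card (V - S) \<le> (card (S \<inter> U) choose 2)"
      by (rule card_uncovered_le[OF S g]) (simp_all add: cover verts_eq)
    moreover have "card (U - S) \<le> (card (S \<inter> V) choose 2)"
      by (rule sw.card_uncovered_le[OF S g]) (simp_all add: cover verts_eq)
    ultimately show ?R using S by blast
  next
    assume R: ?R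
    obtain z where z: "\<And>P. z P \<in> V" "V - S \<subseteq> z ` {P. P \<subseteq> S \<inter> U \<and> card P = 2}"
      using inner_vertex_assignment[of "S \<inter> U" S] R by blast
    obtain w where w: "\<And>P. w P \<in> U" "U - S \<subseteq> w ` {P. P \<subseteq> S \<inter> V \<and> card P = 2}"
      using sw.inner_vertex_assignment[of "S \<inter> V" S] R by blast
    \<comment> \<open>The demands on \<open>z P\<close> and \<open>w P\<close> never clash, because
      a pair cannot lie in both parts.\<close>
    have "\<exists>p. (\<exists>x y. P = {x, y} \<and> shortest_vpath G x p y) \<and> P \<subseteq> set p \<and> set p \<subseteq> verts G \<and>
        (P \<subseteq> U \<longrightarrow> z P \<in> set p) \<and> (P \<subseteq> V \<longrightarrow> w P \<in> set p)"
      if P: "P \<subseteq> S" "card P = 2" for P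
    proof -
      obtain x y where xy: "P = {x, y}" "x \<noteq> y" using P(2) by (auto simp: card_2_iff)
      then have "x \<in> U \<union> V" "y \<in> U \<union> V" using P R verts_eq by auto
      then consider "x \<in> U" "y \<in> U" | "x \<in> V" "y \<in> V" | "x \<in> U" "y \<in> V" | "x \<in> V" "y \<in> U"
        by blast
      then show ?thesis
      proof cases
        case 1
        then show ?thesis
          using xy z(1)[of P] shortest_vpath_via[of x y "z P"] disjoint verts_eq
          by (intro exI[of _ "[x, z P, y]"]) auto
      next
        case 2
        then show ?thesis
          using xy w(1)[of P] sw.shortest_vpath_via[of x y "w P"] disjoint verts_eq
          by (intro exI[of _ "[x, w P, y]"]) auto
      next
        case 3
        then show ?thesis
          using xy shortest_vpath_edge[of x y] disjoint verts_eq
          by (intro exI[of _ "[x, y]"]) auto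
      next
        case 4
        then show ?thesis
          using xy sw.shortest_vpath_edge[of x y] disjoint verts_eq
          by (intro exI[of _ "[x, y]"]) auto
      qed
    qed
    then obtain g where g: "\<And>P. P \<subseteq> S \<Longrightarrow> card P = 2 \<Longrightarrow>
        (\<exists>x y. P = {x, y} \<and> shortest_vpath G x (g P) y) \<and> P \<subseteq> set (g P) \<and> set (g P) \<subseteq> verts G \<and>
        (P \<subseteq> U \<longrightarrow> z P \<in> set (g P)) \<and> (P \<subseteq> V \<longrightarrow> w P \<in> set (g P))"
      by metis
    then have path: "\<And>P. P \<subseteq> S \<Longrightarrow> card P = 2 \<Longrightarrow> \<exists>x y. P = {x, y} \<and> shortest_vpath G x (g P) y"
      and ends: "\<And>P. P \<subseteq> S \<Longrightarrow> card P = 2 \<Longrightarrow> P \<subseteq> set (g P)"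
      and sub: "\<And>P. P \<subseteq> S \<Longrightarrow> card P = 2 \<Longrightarrow> set (g P) \<subseteq> verts G"
      and inner: "\<And>P. P \<subseteq> S \<Longrightarrow> card P = 2 \<Longrightarrow> P \<subseteq> U \<Longrightarrow> z P \<in> set (g P)"
        "\<And>P. P \<subseteq> S \<Longrightarrow> card P = 2 \<Longrightarrow> P \<subseteq> V \<Longrightarrow> w P \<in> set (g P)"
      by simp_all
    let ?C = "\<Union>P \<in> {P. P \<subseteq> S \<and> card P = 2}. set (g P)"
    have C: "u \<in> ?C" if "P \<subseteq> S" "card P = 2" "u \<in> set (g P)" for P u
      using that by blast
    have "V - S \<subseteq> z ` {P. P \<subseteq> S \<inter> U \<and> card P = 2}" by (rule z(2))
    also have "\<dots> \<subseteq> ?C"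
    proof (rule image_subsetI)
      fix P assume "P \<in> {P. P \<subseteq> S \<inter> U \<and> card P = 2}"
      then have "P \<subseteq> S" "card P = 2" "P \<subseteq> U" by auto
      then show "z P \<in> ?C" by (intro C[of P] inner)
    qed
    finally have "V - S \<subseteq> ?C" .
    moreover have "U - S \<subseteq> ?C"
    proof -
      have "U - S \<subseteq> w ` {P. P \<subseteq> S \<inter> V \<and> card P = 2}" by (rule w(2))
      also have "\<dots> \<subseteq> ?C"
      proof (rule image_subsetI)
        fix P assume "P \<in> {P. P \<subseteq> S \<inter> V \<and> card P = 2}"
        then have "P \<subseteq> S" "card P = 2" "P \<subseteq> V" by auto
        then show "w P \<in> ?C" by (intro C[of P] inner)
      qed
      finally show ?thesis .
    qed
    moreover have "S \<subseteq> ?C"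
    proof
      fix x assume x: "x \<in> S"
      \<comment> \<open>Vertices of \<open>S\<close> are covered as ends of paths, which requires a
        second vertex of \<open>S\<close>.\<close>
      have "S \<noteq> {x}" using R by auto
      then obtain y where "y \<in> S" "y \<noteq> x" using x by blast
      then have "{x, y} \<subseteq> S" "card {x, y} = 2" using x by auto
      then show "x \<in> ?C" using ends[of "{x, y}"] by (intro C[of "{x, y}"]) simp_all
    qed
    moreover have "?C \<subseteq> verts G" using sub by (intro UN_least) simp
    moreover have "D = verts G"
      if "V - S \<subseteq> D" "U - S \<subseteq> D" "S \<subseteq> D" "D \<subseteq> verts G" for D
      using that verts_eq by blast
    ultimately have "?C = verts G" by metis
    moreover have "\<forall>P. P \<subseteq> S \<and> card P = 2 \<longrightarrow> (\<exists>x y. P = {x, y} \<and> shortest_vpath G x (g P) y)"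
      using path by simp
    ultimately show "strong_geodetic_set G S" unfolding def using R by (intro conjI exI[of _ g]) simp_all
  qed
qed

end

section \<open>Admissible sizes\<close>

text \<open>Here \<open>a\<close> and \<open>b\<close> count the chosen vertices in the parts of
  sizes \<open>n\<close> and \<open>m\<close>. The covering conditions are written additively to
  avoid truncated subtraction.\<close>

definition sg_admissible :: "nat \<Rightarrow> nat \<Rightarrow> nat \<Rightarrow> bool" where
  "sg_admissible n m k \<longleftrightarrow> k \<ge> 2 \<and>
     (\<exists>a b. a + b = k \<and> a \<le> n \<and> b \<le> m \<and> m \<le> b + (a choose 2) \<and> n \<le> a + (b choose 2))"

lemma sg_admissibleI:
  assumes "a + b = k" "k \<ge> 2" "a \<le> n" "b \<le> m" "m \<le> b + (a choose 2)" "n \<le> a + (b choose 2)"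
  shows "sg_admissible n m k"
  using assms unfolding sg_admissible_def by blast

lemma sg_admissibleE:
  assumes "sg_admissible n m k"
  obtains a b where "a + b = k" "k \<ge> 2" "a \<le> n" "b \<le> m"
    "m \<le> b + (a choose 2)" "n \<le> a + (b choose 2)"
  using assms unfolding sg_admissible_def by blast

lemma sg_admissible_commute: "sg_admissible n m k \<longleftrightarrow> sg_admissible m n k"
proof -
  have "sg_admissible m n k" if "sg_admissible n m k" for n m
    using that by (rule sg_admissibleE) (rule sg_admissibleI, auto)
  then show ?thesis by blast
qed

text \<open>The criterion depends on \<open>S\<close> only through the sizes of its intersections
  with the parts, and subsets of all sizes \<open>a\<close> and \<open>b\<close> within range
  exist.\<close>

lemma (in complete_bipartition) ex_strong_geodetic_set_iff:
  "(\<exists>S. strong_geodetic_set G S \<and> card S = k) \<longleftrightarrow> sg_admissible (card U) (card V) k"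
proof
  assume "\<exists>S. strong_geodetic_set G S \<and> card S = k"
  then obtain S where S: "S \<subseteq> U \<union> V" "card S = k" "k \<ge> 2"
    "card (V - S) \<le> (card (S \<inter> U) choose 2)" "card (U - S) \<le> (card (S \<inter> V) choose 2)"
    unfolding strong_geodetic_set_iff verts_eq by blast
  have "S = (S \<inter> U) \<union> (S \<inter> V)" using S by blast
  then have "card S = card (S \<inter> U) + card (S \<inter> V)"
    using card_Un_disjoint[of "S \<inter> U" "S \<inter> V"] finite_parts disjoint by auto
  moreover have "card V = card (S \<inter> V) + card (V - S)" "card U = card (S \<inter> U) + card (U - S)"
    using card_Int_Diff[of V S] card_Int_Diff[of U S] finite_parts by (auto simp: Int_commute)
  ultimately show "sg_admissible (card U) (card V) k"
    using S by (intro sg_admissibleI[of "card (S \<inter> U)" "card (S \<inter> V)"]) auto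
next
  assume "sg_admissible (card U) (card V) k"
  then obtain a b where ab: "a + b = k" "k \<ge> 2" "a \<le> card U" "b \<le> card V"
    "card V \<le> b + (a choose 2)" "card U \<le> a + (b choose 2)"
    by (rule sg_admissibleE)
  obtain A B where A: "A \<subseteq> U" "card A = a" and B: "B \<subseteq> V" "card B = b"
    using ab by (metis obtain_subset_with_card_n)
  have fin: "finite A" "finite B" using A B finite_parts finite_subset by blast+
  have "card (A \<union> B) = k"
    using A B ab fin disjoint by (subst card_Un_disjoint) auto
  moreover have "(A \<union> B) \<inter> U = A" "(A \<union> B) \<inter> V = B" "V - (A \<union> B) = V - B" "U - (A \<union> B) = U - A"
    using A B disjoint by auto
  moreover have "card (V - B) = card V - b" "card (U - A) = card U - a"
    using A B fin by (auto simp: card_Diff_subset)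
  ultimately show "\<exists>S. strong_geodetic_set G S \<and> card S = k"
    using ab A B unfolding strong_geodetic_set_iff verts_eq
    by (intro exI[of _ "A \<union> B"]) auto
qed

section \<open>Upward closure and the least admissible size\<close>

text \<open>Both right-hand sides grow weakly with \<open>a\<close> and with \<open>b\<close>, and
  \<open>k < n + m\<close> leaves an unchosen vertex in some part.\<close>

lemma sg_admissible_Suc:
  assumes "sg_admissible n m k" "k < n + m"
  shows "sg_admissible n m (Suc k)"
proof -
  from assms(1) obtain a b where ab: "a + b = k" "k \<ge> 2" "a \<le> n" "b \<le> m"
    "m \<le> b + (a choose 2)" "n \<le> a + (b choose 2)"
    by (rule sg_admissibleE)
  have mono: "(c choose 2) \<le> (Suc c choose 2)" for c by (intro binomial_right_mono) simp
  show ?thesis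
  proof (cases "a < n")
    case True
    then show ?thesis
      using ab mono[of a] by (intro sg_admissibleI[of "Suc a" b]) linarith+
  next
    case False
    then show ?thesis
      using ab assms(2) mono[of b] by (intro sg_admissibleI[of a "Suc b"]) linarith+
  qed
qed

lemma Least_sg_admissible_eq_iff:
  assumes "n > 0" "m > 0" "k > 0"
  shows "(LEAST s. sg_admissible n m s) = k \<longleftrightarrow>
    sg_admissible n m k \<and> \<not> sg_admissible n m (k - 1)"
proof
  have "sg_admissible n m (n + m)"
    using assms by (intro sg_admissibleI[of n m]) auto
  then have "sg_admissible n m (LEAST s. sg_admissible n m s)" by (rule LeastI)
  then show "sg_admissible n m k \<and> \<not> sg_admissible n m (k - 1)"
    if "(LEAST s. sg_admissible n m s) = k"
    using that assms not_less_Least[of "k - 1" "sg_admissible n m"] by auto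
next
  assume adm: "sg_admissible n m k \<and> \<not> sg_admissible n m (k - 1)"
  then have "k \<le> n + m" by (auto simp: sg_admissible_def)
  show "(LEAST s. sg_admissible n m s) = k"
  proof (rule Least_equality)
    fix j assume j: "sg_admissible n m j"
    show "k \<le> j"
    proof (rule ccontr)
      assume "\<not> k \<le> j"
      then have "j \<le> k - 1" by simp
      \<comment> \<open>A smaller admissible \<open>j\<close> would propagate upwards to
        \<open>k - 1\<close>, never leaving the range below \<open>n + m\<close>.\<close>
      then have "sg_admissible n m (k - 1)"
        using \<open>k \<le> n + m\<close> j by (induction rule: dec_induct) (auto intro!: sg_admissible_Suc)
      with adm show False by blast
    qed
  qed (use adm in blast)
qed

section \<open>Comparison with the bound\<close>

text \<open>The maximum flattens the binomial to \<open>2 choose 2 = 1\<close>, which cancels the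
  \<open>- 1\<close>; negative arguments are included.\<close>

lemma sg_bound_le_3: "x \<le> 3 \<Longrightarrow> sg_bound k x = k"
  by (simp add: sg_bound_def max_def)

lemma sg_bound_mono: "x \<le> y \<Longrightarrow> sg_bound k x \<le> sg_bound k y"
  unfolding sg_bound_def by (auto intro!: binomial_right_mono nat_mono max.mono)

lemma sg_bound_ge: "k \<le> sg_bound k x"
  using sg_bound_mono[of "min x 3" x k] sg_bound_le_3[of "min x 3" k] by simp

lemma sg_bound_pred: "sg_bound (k - 1) x = sg_bound k x - 1"
  by (simp add: sg_bound_def)

text \<open>Pascal's rule gives \<open>a choose 2 = (a - 1) + (a - 1 choose 2)\<close>, and
  \<open>b + (a - 1) = k - 1\<close>.\<close>

lemma sg_bound_eq_choose:
  assumes "a + b = k" "a \<ge> 3"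
  shows "sg_bound (int k) (int a) = int (b + (a choose 2))"
proof -
  obtain c where c: "a = Suc c" using assms by (cases a) auto
  then have "nat (max (int a - 1) 2) = c" using assms by simp
  moreover have "(a choose 2) = c + (c choose 2)"
    using c by (simp add: numeral_2_eq_2)
  ultimately show ?thesis using assms c by (simp add: sg_bound_def)
qed

text \<open>For \<open>a = 0, 1, 2\<close> the left side is \<open>k\<close>, \<open>k - 1\<close>,
  \<open>k - 1\<close>, while the bound is \<open>k\<close>.\<close>

lemma choose_le_sg_bound:
  assumes "a + b = k"
  shows "int (b + (a choose 2)) \<le> sg_bound (int k) (int a)"
proof (cases "a \<ge> 3")
  case True
  then show ?thesis using sg_bound_eq_choose[OF assms] by simp
next
  case False
  then have "a = 0 \<or> a = 1 \<or> a = 2" by auto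
  then show ?thesis using assms sg_bound_le_3[of "int a" "int k"] by (auto simp: binomial_eq_0)
qed

lemma sg_bound_admissibleE:
  assumes "sg_admissible n m k"
  obtains a b where "a + b = k" "a \<le> n" "b \<le> m"
    "int m \<le> sg_bound (int k) (int a)" "int n \<le> sg_bound (int k) (int b)"
proof -
  from assms obtain a b where ab: "a + b = k" "a \<le> n" "b \<le> m"
    "m \<le> b + (a choose 2)" "n \<le> a + (b choose 2)"
    by (rule sg_admissibleE)
  then show ?thesis
    using that[of a b] choose_le_sg_bound[of a b k] choose_le_sg_bound[of b a k] by simp
qed

text \<open>For these \<open>n\<close> the value \<open>n choose 2\<close> is
  \<open>f(n, n)\<close>, and \<open>f(n, x)\<close> is always at least \<open>n\<close>.\<close>

lemma le_choose_2: "n \<ge> 3 \<Longrightarrow> n \<le> (n choose 2)"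
  using sg_bound_eq_choose[of n 0 n] sg_bound_ge[of "int n" "int n"] by simp

section \<open>Sizes larger than one part, and sizes up to both parts\<close>

text \<open>Since \<open>a <= n\<close>, admissibility of \<open>k\<close> forces
  \<open>m <= f(k, n)\<close>, and that of \<open>k - 1\<close> forces
  \<open>m <= f(k, n) - 1\<close>. For \<open>n >= 3\<close> both bounds are attained by choosing
  the whole part of size \<open>n\<close>; smaller \<open>n\<close> require other splits.\<close>

lemma admissible_left_iff:
  assumes "0 < n" "0 < m" "(n, m) \<notin> {(1, 1), (2, 2)}" "n < k"
  shows "sg_admissible n m k \<and> \<not> sg_admissible n m (k - 1) \<longleftrightarrow>
    int m = sg_bound (int k) (int n)"
proof
  assume eq: "int m = sg_bound (int k) (int n)"
  have "m \<ge> k" using sg_bound_ge[of "int k" "int n"] eq by simp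
  have "sg_admissible n m k"
  proof (cases "n \<ge> 3")
    case True
    then show ?thesis
      using sg_bound_eq_choose[of n "k - n" k] eq assms \<open>m \<ge> k\<close>
      by (intro sg_admissibleI[of n "k - n"]) auto
  next
    case False
    \<comment> \<open>Taking \<open>a = n\<close> would only reach \<open>m <= k - 1\<close> here,
      so all \<open>k\<close> vertices are taken from the other part.\<close>
    then have "m = k" using eq sg_bound_le_3[of "int n" "int k"] by simp
    moreover have "n \<le> (k choose 2)"
    proof (cases "k \<ge> 3")
      case True
      then show ?thesis using le_choose_2[of k] assms by simp
    next
      case False
      then have "n = 1" "k = 2" using assms by auto
      then show ?thesis by simp
    qed
    ultimately show ?thesis using assms by (intro sg_admissibleI[of 0 k]) auto
  qed
  moreover have "\<not> sg_admissible n m (k - 1)"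
  proof
    assume "sg_admissible n m (k - 1)"
    then obtain a where a: "a \<le> n" "int m \<le> sg_bound (int (k - 1)) (int a)"
      by (rule sg_bound_admissibleE)
    have "int (k - 1) = int k - 1" using assms by simp
    then show False
      using a sg_bound_mono[of "int a" "int n" "int k"] eq by (simp add: sg_bound_pred)
  qed
  ultimately show "sg_admissible n m k \<and> \<not> sg_admissible n m (k - 1)" by blast
next
  assume adm: "sg_admissible n m k \<and> \<not> sg_admissible n m (k - 1)"
  then have "k \<ge> 2" by (auto simp: sg_admissible_def)
  obtain a b where ab: "a + b = k" "a \<le> n" "b \<le> m" "int m \<le> sg_bound (int k) (int a)"
    using adm by (auto elim: sg_bound_admissibleE)
  then have le: "int m \<le> sg_bound (int k) (int n)"
    using sg_bound_mono[of "int a" "int n" "int k"] by simp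
  show "int m = sg_bound (int k) (int n)"
  proof (rule ccontr)
    assume "\<not> ?thesis"
    then have less: "int m < sg_bound (int k) (int n)" using le by simp
    have "sg_admissible n m (k - 1)"
    proof (cases "n \<ge> 3")
      case True
      then have "m < k - n + (n choose 2)"
        using sg_bound_eq_choose[of n "k - n" k] less assms by simp
      then show ?thesis
        using True ab assms by (intro sg_admissibleI[of n "k - 1 - n"]) auto
    next
      case False
      then have "m < k" using less sg_bound_le_3[of "int n" "int k"] by simp
      \<comment> \<open>Only these cases remain, by \<open>k = a + b <= n + m\<close>. The excluded
        pairs \<open>(1, 1)\<close> and \<open>(2, 2)\<close> are what would break the first and the
        second one.\<close>
      consider "m = k - 1" "n = 1" | "m = k - 1" "n = 2" | "m = k - 2" "n = 2"
        using False \<open>m < k\<close> ab assms by linarith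
      then show ?thesis
      proof cases
        case 1
        then have "m \<ge> 2" using assms by auto
        then have "(m choose 2) \<ge> 1" by (simp add: Suc_leI)
        then show ?thesis using 1 \<open>m \<ge> 2\<close> by (intro sg_admissibleI[of 0 m]) auto
      next
        case 2
        then have "m \<ge> 3" using assms by auto
        then show ?thesis using 2 le_choose_2[of m] assms
          by (intro sg_admissibleI[of 0 m]) auto
      next
        case 3
        then show ?thesis using assms by (intro sg_admissibleI[of 2 "m - 1"]) auto
      qed
    qed
    with adm show False by blast
  qed
qed

text \<open>The upper bounds in the existential make \<open>k\<close> admissible, the lower ones
  make \<open>k - 1\<close> inadmissible. With \<open>k <= n\<close> and \<open>k <= m\<close>, the
  requirements \<open>a <= n\<close> and \<open>b <= m\<close> hold for every split of
  \<open>k\<close>.\<close>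

lemma admissible_ge_iff:
  assumes "0 < k" "(n, m) \<notin> {(1, 1), (2, 2)}" "k \<le> n" "k \<le> m"
  shows "sg_admissible n m k \<and> \<not> sg_admissible n m (k - 1) \<longleftrightarrow>
    (\<exists>i::int. 0 \<le> i \<and> i \<le> int k \<and>
       sg_bound (int k) (i - 1) \<le> int m \<and> int m \<le> sg_bound (int k) i \<and>
       sg_bound (int k) (int k - i - 1) \<le> int n \<and> int n \<le> sg_bound (int k) (int k - i))"
proof
  have pred: "int (k - 1) = int k - 1" using assms by simp
  {
    assume "\<exists>i::int. 0 \<le> i \<and> i \<le> int k \<and>
       sg_bound (int k) (i - 1) \<le> int m \<and> int m \<le> sg_bound (int k) i \<and>
       sg_bound (int k) (int k - i - 1) \<le> int n \<and> int n \<le> sg_bound (int k) (int k - i)"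
    then obtain i :: int where i: "0 \<le> i" "i \<le> int k"
       "sg_bound (int k) (i - 1) \<le> int m" "int m \<le> sg_bound (int k) i"
       "sg_bound (int k) (int k - i - 1) \<le> int n" "int n \<le> sg_bound (int k) (int k - i)"
      by blast
    define a b where "a = nat i" and "b = nat (int k - i)"
    have ab: "a + b = k" "int a = i" "int b = int k - i" using i by (auto simp: a_def b_def)
    \<comment> \<open>For \<open>k <= 2\<close> all the bounds equal \<open>k\<close>, which forces
      \<open>n = m = k\<close>, an excluded pair.\<close>
    have "k \<ge> 3"
    proof (rule ccontr)
      assume "\<not> k \<ge> 3"
      then have "n = k" "m = k" "k = 1 \<or> k = 2"
        using i assms sg_bound_le_3[of i "int k"] sg_bound_le_3[of "int k - i" "int k"] by auto
      then show False using assms by auto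
    qed
    have bound_k: "int m \<le> int (k choose 2)" "int n \<le> int (k choose 2)"
      using i sg_bound_mono[of i "int k" "int k"] sg_bound_mono[of "int k - i" "int k" "int k"]
        sg_bound_eq_choose[of k 0 k] \<open>k \<ge> 3\<close> by auto
    \<comment> \<open>A part size above \<open>k\<close> needs a bound above \<open>k\<close>, hence
      \<open>c >= 3\<close>, where the bound is exact.\<close>
    have choose: "j \<le> d + (c choose 2)"
      if "int j \<le> sg_bound (int k) (int c)" "j \<noteq> k" "c + d = k" "k \<le> j" for j c d
    proof -
      have "c \<ge> 3" using that sg_bound_le_3[of "int c" "int k"] by (cases "c \<ge> 3") auto
      then show ?thesis using sg_bound_eq_choose[of c d k] that by simp
    qed
    have "sg_admissible n m k"
    proof -
      \<comment> \<open>If a part has exactly \<open>k\<close> vertices, the split given by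
        \<open>i\<close> may fall short by one; choosing that whole part works instead.\<close>
      consider "m = k" | "n = k" | "m \<noteq> k" "n \<noteq> k" by blast
      then show ?thesis
      proof cases
        case 1
        then show ?thesis using bound_k \<open>k \<ge> 3\<close> by (intro sg_admissibleI[of 0 k]) auto
      next
        case 2
        then show ?thesis using bound_k \<open>k \<ge> 3\<close> by (intro sg_admissibleI[of k 0]) auto
      next
        case 3
        then show ?thesis
          using ab i assms \<open>k \<ge> 3\<close> choose[of m a b] choose[of n b a]
          by (intro sg_admissibleI[of a b]) auto
      qed
    qed
    moreover have "\<not> sg_admissible n m (k - 1)"
    proof
      assume "sg_admissible n m (k - 1)"
      then obtain c d where cd: "c + d = k - 1"
        "int m \<le> sg_bound (int k - 1) (int c)" "int n \<le> sg_bound (int k - 1) (int d)"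
        unfolding pred[symmetric] by (rule sg_bound_admissibleE)
      \<comment> \<open>The bounds for \<open>k - 1\<close> are smaller by one, so the lower bounds
        force \<open>c >= i\<close> and \<open>d >= k - i\<close>, too much for
        \<open>c + d = k - 1\<close>.\<close>
      have "int c > i - 1" using sg_bound_mono[of "int c" "i - 1" "int k"] cd i
        unfolding sg_bound_pred by linarith
      moreover have "int d > int k - i - 1"
        using sg_bound_mono[of "int d" "int k - i - 1" "int k"] cd i
        unfolding sg_bound_pred by linarith
      ultimately show False using cd(1) pred by linarith
    qed
    ultimately show "sg_admissible n m k \<and> \<not> sg_admissible n m (k - 1)" by blast
  }
  assume adm: "sg_admissible n m k \<and> \<not> sg_admissible n m (k - 1)"
  then obtain a b where ab: "a + b = k"
    "int m \<le> sg_bound (int k) (int a)" "int n \<le> sg_bound (int k) (int b)"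
    by (auto elim: sg_bound_admissibleE)
  let ?I = "{i. i \<le> k \<and> int n \<le> sg_bound (int k) (int k - int i) \<and>
    sg_bound (int k) (int i - 1) \<le> int m}"
  \<comment> \<open>Index \<open>0\<close> qualifies because \<open>f(k, -1) = k <= m\<close> and
    \<open>n <= f(k, b) <= f(k, k)\<close>.\<close>
  have "0 \<in> ?I"
    using ab assms sg_bound_mono[of "int b" "int k" "int k"] sg_bound_le_3[of "-1" "int k"] by auto
  moreover have "finite ?I" by simp
  ultimately obtain i where i: "i \<in> ?I" and max: "\<And>j. j \<in> ?I \<Longrightarrow> j \<le> i"
    using Max_in[of ?I] Max_ge[of ?I] by blast
  have no_next: "False" if "i < k" "int n \<le> sg_bound (int k) (int k - int i - 1)"
    "sg_bound (int k) (int i) \<le> int m"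
    using max[of "Suc i"] that by (simp add: algebra_simps)
  \<comment> \<open>Otherwise \<open>i < a\<close>, hence \<open>b <= k - i - 1\<close>, and
    \<open>i + 1\<close> would qualify as well.\<close>
  have upper: "int m \<le> sg_bound (int k) (int i)"
  proof (rule ccontr)
    assume m: "\<not> ?thesis"
    then have "i < a" using ab sg_bound_mono[of "int a" "int i" "int k"] by linarith
    then have "int n \<le> sg_bound (int k) (int k - int i - 1)"
      using ab sg_bound_mono[of "int b" "int k - int i - 1" "int k"] by linarith
    moreover have "sg_bound (int k) (int i) \<le> int m" using m by simp
    ultimately show False using no_next \<open>i < a\<close> ab by simp
  qed
  \<comment> \<open>Here the inadmissibility of \<open>k - 1\<close> enters: otherwise maximality of
    \<open>i\<close> gives \<open>m < f(k, i)\<close>, both indices are at least 3, the bounds are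
    exact, and the split \<open>i\<close>, \<open>k - 1 - i\<close> witnesses
    \<open>k - 1\<close>.\<close>
  have lower: "sg_bound (int k) (int k - int i - 1) \<le> int n"
  proof (rule ccontr)
    assume n: "\<not> ?thesis"
    have big: "x \<ge> 3" if "sg_bound (int k) x > int k" for x
      using that sg_bound_le_3[of x "int k"] by linarith
    have "int k - int i - 1 \<ge> 3" using n assms by (intro big) linarith
    then have "i < k" by linarith
    then have m: "int m < sg_bound (int k) (int i)" using no_next n by (meson linorder_not_le less_imp_le)
    then have "int i \<ge> 3" using assms by (intro big) linarith
    have j: "int (k - 1 - i) = int k - int i - 1" "k - 1 - i \<ge> 3"
      using \<open>i < k\<close> \<open>int k - int i - 1 \<ge> 3\<close> by auto
    have "sg_admissible n m (k - 1)"
    proof (rule sg_admissibleI)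
      show "i + (k - 1 - i) = k - 1" using \<open>i < k\<close> by simp
      show "m \<le> k - 1 - i + (i choose 2)"
        using sg_bound_eq_choose[of i "k - 1 - i" "k - 1"] \<open>i < k\<close> \<open>int i \<ge> 3\<close> m
        by (simp add: pred sg_bound_pred)
      show "n \<le> i + (k - 1 - i choose 2)"
        using sg_bound_eq_choose[OF _ j(2), of i "k - 1"] \<open>i < k\<close> n
        unfolding pred sg_bound_pred j(1) by linarith
    qed (use assms \<open>i < k\<close> \<open>int i \<ge> 3\<close> in auto)
    with adm show False by blast
  qed
  show "\<exists>i::int. 0 \<le> i \<and> i \<le> int k \<and>
       sg_bound (int k) (i - 1) \<le> int m \<and> int m \<le> sg_bound (int k) i \<and>
       sg_bound (int k) (int k - i - 1) \<le> int n \<and> int n \<le> sg_bound (int k) (int k - i)"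
    using i upper lower by (intro exI[of _ "int i"]) auto
qed

section \<open>The strong geodetic number of a complete bipartite graph\<close>

theorem theorem2p1:
  fixes n m k :: nat and G :: "('a, 'b) pre_digraph"
  assumes "n > 0" and "m > 0" and "k > 0"
    and "complete_bipartite_digraph n m G"
  shows "((n, m) \<notin> {(1, 1), (2, 2)} \<longrightarrow>
           (strong_geodetic_number G = k \<longleftrightarrow>
              (n < k \<and> int m = sg_bound (int k) (int n)) \<or>
              (m < k \<and> int n = sg_bound (int k) (int m)) \<or>
              (\<exists>i::int. 0 \<le> i \<and> i \<le> int k \<and>
                 sg_bound (int k) (i - 1) \<le> int m \<and> int m \<le> sg_bound (int k) i \<and>
                 sg_bound (int k) (int k - i - 1) \<le> int n \<and> int n \<le> sg_bound (int k) (int k - i)))) \<and>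
         ((n, m) = (1, 1) \<longrightarrow> strong_geodetic_number G = 2) \<and>
         ((n, m) = (2, 2) \<longrightarrow> strong_geodetic_number G = 3)"
proof -
  obtain U V where UV: "verts G = U \<union> V" "U \<inter> V = {}" "card U = n" "card V = m"
    "arcs_ends G = U \<times> V \<union> V \<times> U"
    using assms(4) unfolding complete_bipartite_digraph_def by blast
  interpret complete_bipartition G U V
    using UV assms(1,2) card_gt_0_iff[of U] card_gt_0_iff[of V] by unfold_locales auto
  have number: "strong_geodetic_number G = (LEAST s. sg_admissible n m s)"
    unfolding strong_geodetic_number_def ex_strong_geodetic_set_iff UV ..
  have iff: "strong_geodetic_number G = j \<longleftrightarrow> sg_admissible n m j \<and> \<not> sg_admissible n m (j - 1)"
    if "j > 0" for j
    unfolding number using Least_sg_admissible_eq_iff assms(1,2) that by blast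
  let ?iii = "\<exists>i::int. 0 \<le> i \<and> i \<le> int k \<and>
     sg_bound (int k) (i - 1) \<le> int m \<and> int m \<le> sg_bound (int k) i \<and>
     sg_bound (int k) (int k - i - 1) \<le> int n \<and> int n \<le> sg_bound (int k) (int k - i)"
  have "strong_geodetic_number G = k \<longleftrightarrow>
      n < k \<and> int m = sg_bound (int k) (int n) \<or>
      m < k \<and> int n = sg_bound (int k) (int m) \<or> ?iii"
    if ne: "(n, m) \<notin> {(1, 1), (2, 2)}"
  proof -
    \<comment> \<open>Every value \<open>f(k, x)\<close> is at least \<open>k\<close>, so condition
      (iii) is confined to the case where both parts have at least \<open>k\<close>
      vertices.\<close>
    have ge: "n \<ge> k" "m \<ge> k" if ?iii
      using that sg_bound_ge[of "int k"] by (meson of_nat_le_iff order_trans)+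
    have nk: "n < k \<Longrightarrow> strong_geodetic_number G = k \<longleftrightarrow> int m = sg_bound (int k) (int n)"
      using admissible_left_iff[OF assms(1,2) ne] iff[OF assms(3)] by blast
    have mk: "m < k \<Longrightarrow> strong_geodetic_number G = k \<longleftrightarrow> int n = sg_bound (int k) (int m)"
      using admissible_left_iff[OF assms(2,1)] ne iff[OF assms(3)]
      unfolding sg_admissible_commute[of n m] by auto
    have mn: "n \<ge> k \<Longrightarrow> m \<ge> k \<Longrightarrow> strong_geodetic_number G = k \<longleftrightarrow> ?iii"
      using admissible_ge_iff[OF assms(3) ne] iff[OF assms(3)] by blast
    \<comment> \<open>For the same reason neither (i) nor (ii) can hold when both parts have fewer
      than \<open>k\<close> vertices.\<close>
    have "\<not> (n < k \<and> int m = sg_bound (int k) (int n) \<and> m < k)"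
      "\<not> (m < k \<and> int n = sg_bound (int k) (int m) \<and> n < k)"
      using sg_bound_ge[of "int k" "int n"] sg_bound_ge[of "int k" "int m"] by auto
    then show ?thesis using ge nk mk mn by (meson not_le)
  qed
  moreover have "strong_geodetic_number G = 2" if "(n, m) = (1, 1)"
  proof -
    have "sg_admissible n m 2" using that by (intro sg_admissibleI[of 1 1]) auto
    then show ?thesis using iff[of 2] by (auto simp: sg_admissible_def)
  qed
  moreover have "strong_geodetic_number G = 3" if "(n, m) = (2, 2)"
  proof -
    have "sg_admissible n m 3" using that by (intro sg_admissibleI[of 1 2]) auto
    \<comment> \<open>Each split of 2 bounds some part size by 1: \<open>(0, 2)\<close> bounds
      \<open>n\<close>, \<open>(2, 0)\<close> bounds \<open>m\<close>, and \<open>(1, 1)\<close>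
      bounds both.\<close>
    moreover have "\<not> sg_admissible n m 2"
    proof
      assume "sg_admissible n m 2"
      then obtain a b where "a + b = 2" "m \<le> b + (a choose 2)" "n \<le> a + (b choose 2)"
        by (rule sg_admissibleE)
      moreover from this have "a = 0 \<or> a = 1 \<or> a = 2" by auto
      ultimately show False using that by (auto simp: binomial_eq_0)
    qed
    ultimately show ?thesis using iff[of 3] by auto
  qed
  ultimately show ?thesis by blast
qed

end
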